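(* Let $G = (V,E)$ be a graph with $n$ vertices, $e$ edges, minimum degree $\delta \geq 1$, maximum degree $\Delta$, and independence number $\beta$. Then $$M_1(G) \leq (n - \beta)\Delta^2 + \frac{\bigl(e (\delta + n - \beta)\bigr)^2}{4 \delta (n - \beta) \beta},$$ with equality if and only if either $G$ is $K_{\beta,\, n - \beta}$, or $G$ is a bipartite graph with partition sets $I$ and $V - I$ such that $|I| = \beta$, $\delta < n - \beta$, $d(v) = \Delta$ for each vertex $v \in V - I$, and $I = P \cup Q$, where $P = \{x \in I : d(x) = n - \beta\}$, $Q = \{y \in I : d(y) = \delta\}$, $|P| = \frac{\delta \beta}{\delta + n - \beta}$ (an integer) and $|Q| = \frac{(n - \beta)\beta}{\delta + n - \beta}$ (an integer).
   Context: All graphs are finite, undirected, without loops or multiple edges. For a graph $G$, $d(u)$ denotes the degree of a vertex $u$, $\delta$ and $\Delta$ denote the minimum and maximum degree, and the first Zagreb index is $M_1(G) = \sum_{u \in V(G)} d^2(u)$. The independence number $\beta$ is the maximum size of a set of pairwise nonadjacent vertices. $K_{a,b}$ denotes the complete bipartite graph with parts of sizes $a$ and $b$. *)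

theory Defs
  imports Complex_Main "HOL-Library.Ramsey"
begin

text \<open>
  A graph is given by a vertex set \<open>V\<close> and an edge set \<open>E\<close> of two-element subsets of \<open>V\<close>;
  this rules out loops, multiple edges and directions.
\<close>

definition fin_graph :: "'a set \<Rightarrow> 'a set set \<Rightarrow> bool" where
  "fin_graph V E \<longleftrightarrow> finite V \<and> E \<subseteq> [V]\<^bsup>2\<^esup>"

definition degree :: "'a set set \<Rightarrow> 'a \<Rightarrow> nat" where
  "degree E v = card {e \<in> E. v \<in> e}"

text \<open>The two extremal degrees are meaningful only for a finite nonempty vertex set.\<close>

definition min_degree :: "'a set \<Rightarrow> 'a set set \<Rightarrow> nat" where
  "min_degree V E = Min (degree E ` V)"

definition max_degree :: "'a set \<Rightarrow> 'a set set \<Rightarrow> nat" where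
  "max_degree V E = Max (degree E ` V)"

definition first_zagreb :: "'a set \<Rightarrow> 'a set set \<Rightarrow> nat" where
  "first_zagreb V E = (\<Sum>u\<in>V. (degree E u)\<^sup>2)"

definition independent :: "'a set \<Rightarrow> 'a set set \<Rightarrow> 'a set \<Rightarrow> bool" where
  "independent V E S \<longleftrightarrow> S \<subseteq> V \<and> (\<forall>x\<in>S. \<forall>y\<in>S. {x, y} \<notin> E)"

definition independence_number :: "'a set \<Rightarrow> 'a set set \<Rightarrow> nat" where
  "independence_number V E = Max (card ` {S. independent V E S})"

definition bipartite_with :: "'a set \<Rightarrow> 'a set set \<Rightarrow> 'a set \<Rightarrow> 'a set \<Rightarrow> bool" where
  "bipartite_with V E A B \<longleftrightarrow>
     A \<union> B = V \<and> A \<inter> B = {} \<and> (\<forall>e\<in>E. \<exists>x\<in>A. \<exists>y\<in>B. e = {x, y})"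

text \<open>The graph is (isomorphic to) \<open>K\<^bsub>a,b\<^esub>\<close>.\<close>

definition is_complete_bipartite :: "'a set \<Rightarrow> 'a set set \<Rightarrow> nat \<Rightarrow> nat \<Rightarrow> bool" where
  "is_complete_bipartite V E a b \<longleftrightarrow>
     (\<exists>A B. bipartite_with V E A B \<and> card A = a \<and> card B = b \<and>
            (\<forall>x\<in>A. \<forall>y\<in>B. {x, y} \<in> E))"

end

theory Submission
  imports Defs
begin

text \<open>
  Let \<open>I\<close> be a maximum independent set and \<open>m = n - \<beta>\<close>. The vertices outside \<open>I\<close> contribute at
  most \<open>m \<Delta>\<^sup>2\<close>. For \<open>x \<in> I\<close> we have \<open>\<delta> \<le> d x \<le> m\<close>, hence \<open>(d x - \<delta>) (m - d x) \<ge> 0\<close>; summing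
  over \<open>I\<close> and completing the square bounds \<open>\<Sum>x\<in>I. (d x)\<^sup>2\<close> in terms of \<open>S = \<Sum>x\<in>I. d x\<close>, and
  \<open>S \<le> e\<close> because every edge has at most one end in \<open>I\<close>. The defect of each step is an explicit
  nonnegative term, so equality holds iff all of them vanish.
\<close>

section \<open>An upper bound for a sum of squares of reals from an interval\<close>

lemma sum_power2_defect:
  fixes d :: "'a \<Rightarrow> real" and a b t :: real
  assumes "finite I" "I \<noteq> {}" "a > 0" "b > 0"
  defines "k \<equiv> 4 * a * b * real (card I)"
  shows "(t * (a + b))\<^sup>2 / k - (\<Sum>x\<in>I. (d x)\<^sup>2) =
    (\<Sum>x\<in>I. (d x - a) * (b - d x)) + ((a + b) * sum d I - 2 * a * b * real (card I))\<^sup>2 / k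
    + (a + b)\<^sup>2 * (t\<^sup>2 - (sum d I)\<^sup>2) / k"
proof -
  define c S where "c = real (card I)" and "S = sum d I"
  have c: "c > 0"
    using assms by (simp add: c_def card_gt_0_iff)
  have "(\<Sum>x\<in>I. (d x - a) * (b - d x)) = (\<Sum>x\<in>I. (a + b) * d x - a * b - (d x)\<^sup>2)"
    by (intro sum.cong) (auto simp: algebra_simps power2_eq_square)
  also have "\<dots> = (a + b) * S - a * b * c - (\<Sum>x\<in>I. (d x)\<^sup>2)"
    by (simp add: sum_subtractf sum_distrib_left S_def c_def)
  finally have *: "(\<Sum>x\<in>I. (d x - a) * (b - d x)) = \<dots>" .
  \<comment> \<open>With \<open>u = (a + b) * S\<close> and \<open>v = a * b * c\<close>, this is
    the square completion \<open>u * u = (u - 2 * v) * (u - 2 * v) + 4 * v * (u - v)\<close> divided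
    by \<open>4 * v\<close>. The last term accounts for replacing \<open>S\<close> by
    \<open>t\<close>.\<close>
  have "(t * (a + b))\<^sup>2 / (4 * a * b * c) = (a + b) * S - a * b * c
      + ((a + b) * S - 2 * a * b * c)\<^sup>2 / (4 * a * b * c)
      + (a + b)\<^sup>2 * (t\<^sup>2 - S\<^sup>2) / (4 * a * b * c)"
    using assms(3,4) c by (simp add: field_simps power2_eq_square)
  with * show ?thesis
    by (simp add: k_def c_def S_def)
qed

text \<open>All three defect terms are nonnegative: the first since \<open>d x\<close> lies between
  \<open>a\<close> and \<open>b\<close>, the second as a square, the third since
  \<open>0 \<le> sum d I \<le> t\<close>. Equality holds iff each vanishes; once
  \<open>sum d I = t\<close>, the vanishing of the square becomes a condition on \<open>t\<close>.
  In the application \<open>t\<close> is the number of edges.\<close>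

lemma sum_power2_bound:
  fixes d :: "'a \<Rightarrow> real" and a b t :: real
  assumes fin: "finite I" and ne: "I \<noteq> {}" and a: "a > 0"
    and d: "\<And>x. x \<in> I \<Longrightarrow> a \<le> d x \<and> d x \<le> b" and t: "sum d I \<le> t"
  defines "B \<equiv> (t * (a + b))\<^sup>2 / (4 * a * b * real (card I))"
  shows "(\<Sum>x\<in>I. (d x)\<^sup>2) \<le> B"
    and "(\<Sum>x\<in>I. (d x)\<^sup>2) = B \<longleftrightarrow>
      sum d I = t \<and> (\<forall>x\<in>I. d x = a \<or> d x = b) \<and> (a + b) * t = 2 * a * b * real (card I)"
proof -
  define k where "k = 4 * a * b * real (card I)"
  obtain x where "x \<in> I" using ne by blast
  then have b: "b > 0" using d[of x] a by linarith
  have k: "k > 0" using a b fin ne by (simp add: k_def card_gt_0_iff)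
  have S: "sum d I \<ge> 0" using d a by (intro sum_nonneg) (meson less_le_trans order_less_imp_le)
  define D1 D2 D3 where "D1 = (\<Sum>x\<in>I. (d x - a) * (b - d x))"
    and "D2 = ((a + b) * sum d I - 2 * a * b * real (card I))\<^sup>2 / k"
    and "D3 = (a + b)\<^sup>2 * (t\<^sup>2 - (sum d I)\<^sup>2) / k"
  have eq: "B - (\<Sum>x\<in>I. (d x)\<^sup>2) = D1 + D2 + D3"
    unfolding B_def D1_def D2_def D3_def k_def using sum_power2_defect[OF fin ne a b] by blast
  have D1: "D1 \<ge> 0" unfolding D1_def using d by (intro sum_nonneg mult_nonneg_nonneg) auto
  have D2: "D2 \<ge> 0" using k by (simp add: D2_def)
  have D3: "D3 \<ge> 0" using k t S by (simp add: D3_def power_mono)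
  show "(\<Sum>x\<in>I. (d x)\<^sup>2) \<le> B" using eq D1 D2 D3 by linarith
  have "D1 = 0 \<longleftrightarrow> (\<forall>x\<in>I. (d x - a) * (b - d x) = 0)"
    unfolding D1_def using fin d by (intro sum_nonneg_eq_0_iff mult_nonneg_nonneg) auto
  then have "D1 = 0 \<longleftrightarrow> (\<forall>x\<in>I. d x = a \<or> d x = b)" by auto
  moreover have "D2 = 0 \<longleftrightarrow> (a + b) * sum d I = 2 * a * b * real (card I)"
    using k by (simp add: D2_def)
  \<comment> \<open>Both \<open>t\<close> and \<open>sum d I\<close> are nonnegative, so equal
    squares force equal values.\<close>
  moreover have "D3 = 0 \<longleftrightarrow> sum d I = t"
    using k a b S t by (auto simp: D3_def)
  moreover have "(\<Sum>x\<in>I. (d x)\<^sup>2) = B \<longleftrightarrow> D1 = 0 \<and> D2 = 0 \<and> D3 = 0"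
    using eq D1 D2 D3 by linarith
  ultimately show "(\<Sum>x\<in>I. (d x)\<^sup>2) = B \<longleftrightarrow>
      sum d I = t \<and> (\<forall>x\<in>I. d x = a \<or> d x = b) \<and> (a + b) * t = 2 * a * b * real (card I)"
    by auto
qed

section \<open>Edges and neighbourhoods\<close>

lemma fin_graph_finite:
  assumes "fin_graph V E"
  shows "finite V" "finite E"
proof -
  show "finite V" using assms by (simp add: fin_graph_def)
  then show "finite E"
    using assms finite_subset[OF _ finite_imp_finite_nsets] by (simp add: fin_graph_def)
qed

lemma fin_graph_edgeE:
  assumes "fin_graph V E" "f \<in> E"
  obtains x y where "f = {x, y}" "x \<in> V" "y \<in> V" "x \<noteq> y"
proof -
  have "f \<subseteq> V" "card f = 2" using assms by (auto simp: fin_graph_def nsets_def)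
  then show thesis using that by (auto simp: card_2_iff)
qed

text \<open>The map sending \<open>y\<close> to \<open>{x, y}\<close> is a bijection from the
  neighbours of \<open>x\<close> onto the edges at \<open>x\<close>. Counting neighbours makes
  degrees comparable with sizes of vertex sets.\<close>

lemma degree_eq_card_neighbours:
  assumes "fin_graph V E"
  shows "degree E x = card {y. {x, y} \<in> E}"
proof -
  have "{f \<in> E. x \<in> f} = (\<lambda>y. {x, y}) ` {y. {x, y} \<in> E}"
  proof (intro equalityI subsetI)
    fix f assume f: "f \<in> {f \<in> E. x \<in> f}"
    then obtain u v where "f = {u, v}" using fin_graph_edgeE[OF assms] by blast
    with f obtain w where "f = {x, w}" by blast
    with f show "f \<in> (\<lambda>y. {x, y}) ` {y. {x, y} \<in> E}" by blast
  qed auto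
  moreover have "inj_on (\<lambda>y. {x, y}) {y. {x, y} \<in> E}"
    by (auto simp: inj_on_def doubleton_eq_iff)
  ultimately show ?thesis
    by (simp add: degree_def card_image)
qed

section \<open>Degrees inside an independent set\<close>

lemma independent_neighbours:
  assumes "fin_graph V E" "independent V E I" "x \<in> I"
  shows "{y. {x, y} \<in> E} \<subseteq> V - I"
proof
  fix y assume y: "y \<in> {y. {x, y} \<in> E}"
  then have "{x, y} \<in> E" by simp
  then obtain u v where "{x, y} = {u, v}" "u \<in> V" "v \<in> V"
    by (rule fin_graph_edgeE[OF assms(1)])
  then have "y \<in> V" by (auto simp: doubleton_eq_iff)
  with y assms show "y \<in> V - I" by (auto simp: independent_def)
qed

text \<open>All neighbours of \<open>x\<close> lie outside \<open>I\<close>. This supplies the upper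
  end of the interval in the real inequality.\<close>

lemma degree_le_independent:
  assumes "fin_graph V E" "independent V E I" "x \<in> I"
  shows "degree E x \<le> card (V - I)"
  using assms independent_neighbours[OF assms] fin_graph_finite(1)[OF assms(1)]
  by (simp add: degree_eq_card_neighbours card_mono)

text \<open>An edge at two distinct vertices of \<open>I\<close> would join them, against
  independence. So the edge sets at the vertices of \<open>I\<close> are disjoint, and the sum
  counts each edge meeting \<open>I\<close> once.\<close>

lemma sum_degree_independent:
  assumes "fin_graph V E" "independent V E I"
  shows "(\<Sum>x\<in>I. degree E x) = card {f \<in> E. f \<inter> I \<noteq> {}}"
proof -
  have fin: "finite I"
    using assms fin_graph_finite(1) finite_subset by (auto simp: independent_def)
  have "{f \<in> E. f \<inter> I \<noteq> {}} = (\<Union>x\<in>I. {f \<in> E. x \<in> f})" by auto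
  moreover have "{f \<in> E. x \<in> f} \<inter> {f \<in> E. y \<in> f} = {}" if "x \<in> I" "y \<in> I" "x \<noteq> y" for x y
  proof -
    have False if "f \<in> E" "x \<in> f" "y \<in> f" for f
    proof -
      obtain u v where "f = {u, v}" using \<open>f \<in> E\<close> fin_graph_edgeE[OF assms(1)] by blast
      with that \<open>x \<noteq> y\<close> have "f = {x, y}" by auto
      with \<open>f \<in> E\<close> \<open>x \<in> I\<close> \<open>y \<in> I\<close> assms(2) show False by (auto simp: independent_def)
    qed
    then show ?thesis by auto
  qed
  ultimately show ?thesis
    using fin fin_graph_finite(2)[OF assms(1)]
    by (simp add: degree_def card_UN_disjoint)
qed

lemma sum_degree_independent_le:
  assumes "fin_graph V E" "independent V E I"
  shows "(\<Sum>x\<in>I. degree E x) \<le> card E"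
  using fin_graph_finite(2)[OF assms(1)]
  by (simp add: sum_degree_independent[OF assms] card_mono)

text \<open>The sum counts the edges meeting \<open>I\<close>, so it reaches \<open>card E\<close>
  iff every edge meets \<open>I\<close>; by independence the other end is then in
  \<open>V - I\<close>. This turns the equality case \<open>sum d I = t\<close> into graph
  structure.\<close>

lemma bipartite_with_iff_sum_degree:
  assumes "fin_graph V E" "independent V E I"
  shows "bipartite_with V E I (V - I) \<longleftrightarrow> (\<Sum>x\<in>I. degree E x) = card E"
proof -
  have I: "I \<subseteq> V" using assms(2) by (simp add: independent_def)
  define F where "F = {f \<in> E. f \<inter> I \<noteq> {}}"
  have "(\<Sum>x\<in>I. degree E x) = card F"
    using sum_degree_independent[OF assms] by (simp add: F_def)
  moreover have "F \<subseteq> E" by (auto simp: F_def)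
  ultimately have "(\<Sum>x\<in>I. degree E x) = card E \<longleftrightarrow> F = E"
    using card_subset_eq[OF fin_graph_finite(2)[OF assms(1)], of F] by auto
  also have "\<dots> \<longleftrightarrow> (\<forall>f\<in>E. \<exists>x\<in>I. x \<in> f)" unfolding F_def by blast
  also have "\<dots> \<longleftrightarrow> (\<forall>f\<in>E. \<exists>x\<in>I. \<exists>y\<in>V - I. f = {x, y})"
  proof (intro ball_cong refl)
    fix f assume f: "f \<in> E"
    show "(\<exists>x\<in>I. x \<in> f) \<longleftrightarrow> (\<exists>x\<in>I. \<exists>y\<in>V - I. f = {x, y})"
    proof
      assume "\<exists>x\<in>I. x \<in> f"
      then obtain x where x: "x \<in> I" "x \<in> f" by blast
      obtain u v where "f = {u, v}" using f fin_graph_edgeE[OF assms(1)] by blast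
      with x obtain y where y: "f = {x, y}" by blast
      with x f independent_neighbours[OF assms x(1)] show "\<exists>x\<in>I. \<exists>y\<in>V - I. f = {x, y}" by blast
    qed auto
  qed
  finally show ?thesis using I by (auto simp: bipartite_with_def)
qed

section \<open>Bipartite graphs and completeness\<close>

lemma bipartite_with_independent:
  assumes "bipartite_with V E A B"
  shows "independent V E A" "independent V E B" "B = V - A" "A = V - B"
proof -
  have AB: "A \<union> B = V" "A \<inter> B = {}" and E: "\<And>f. f \<in> E \<Longrightarrow> \<exists>x\<in>A. \<exists>y\<in>B. f = {x, y}"
    using assms by (auto simp: bipartite_with_def)
  show "B = V - A" "A = V - B" using AB by auto
  have "{x, y} \<notin> E" if "{x, y} \<subseteq> A \<or> {x, y} \<subseteq> B" for x y
    using E[of "{x, y}"] AB(2) that by (auto simp: doubleton_eq_iff)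
  with AB(1) show "independent V E A" "independent V E B"
    by (auto simp: independent_def)
qed

lemma bipartite_with_commute:
  "bipartite_with V E A B \<longleftrightarrow> bipartite_with V E B A"
  unfolding bipartite_with_def by (metis Int_commute Un_commute insert_commute)

text \<open>The neighbourhood of \<open>x\<close> is a subset of the finite set \<open>B\<close>,
  hence equals \<open>B\<close> iff it has the same size. Completeness can thus be read off the
  degrees on one side.\<close>

lemma complete_bipartite_iff_degree:
  assumes G: "fin_graph V E" and bip: "bipartite_with V E A B"
  shows "(\<forall>x\<in>A. \<forall>y\<in>B. {x, y} \<in> E) \<longleftrightarrow> (\<forall>x\<in>A. degree E x = card B)"
proof (intro ball_cong refl)
  fix x assume x: "x \<in> A"
  have B: "finite B" using bip fin_graph_finite(1)[OF G] by (auto simp: bipartite_with_def)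
  have sub: "{y. {x, y} \<in> E} \<subseteq> B"
    using independent_neighbours[OF G bipartite_with_independent(1)[OF bip] x]
      bipartite_with_independent(3)[OF bip] by simp
  have "degree E x = card B \<longleftrightarrow> {y. {x, y} \<in> E} = B"
    unfolding degree_eq_card_neighbours[OF G] using card_subset_eq[OF B sub] by auto
  with sub show "(\<forall>y\<in>B. {x, y} \<in> E) \<longleftrightarrow> degree E x = card B" by auto
qed

section \<open>The independence number\<close>

lemma finite_independent:
  assumes "finite V"
  shows "finite {S. independent V E S}"
  by (rule finite_subset[of _ "Pow V"]) (use assms in \<open>auto simp: independent_def\<close>)

lemma card_independent_le:
  assumes "finite V" "independent V E S"
  shows "card S \<le> independence_number V E"
  unfolding independence_number_def using assms finite_independent by (intro Max_ge) auto

lemma maximum_independentE: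
  assumes "finite V"
  obtains I where "independent V E I" "card I = independence_number V E"
proof -
  have "independent V E {}" by (simp add: independent_def)
  then have "independence_number V E \<in> card ` {S. independent V E S}"
    unfolding independence_number_def using finite_independent[OF assms] by (intro Max_in) auto
  with that show thesis by auto
qed

section \<open>The Zagreb bound relative to an independent set\<close>

text \<open>The sum of squared degrees splits into the part over \<open>V - I\<close>, bounded
  termwise by \<open>\<Delta>\<close>, and the part over \<open>I\<close>, bounded by the real
  inequality. The total attains \<open>B\<close> iff both parts attain their bounds.\<close>

lemma zagreb_bound_independent:
  fixes \<delta> \<Delta> :: nat
  assumes G: "fin_graph V E" and I: "independent V E I" "I \<noteq> {}"
    and \<delta>: "\<delta> \<ge> 1" "\<And>v. v \<in> V \<Longrightarrow> \<delta> \<le> degree E v"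
    and \<Delta>: "\<And>v. v \<in> V \<Longrightarrow> degree E v \<le> \<Delta>"
  defines "m \<equiv> real (card (V - I))" and "b \<equiv> real (card I)" and "e \<equiv> real (card E)"
  defines "B \<equiv> m * (real \<Delta>)\<^sup>2 + (e * (real \<delta> + m))\<^sup>2 / (4 * real \<delta> * m * b)"
  shows "real (first_zagreb V E) \<le> B"
    and "real (first_zagreb V E) = B \<longleftrightarrow>
      bipartite_with V E I (V - I) \<and> (\<forall>v\<in>V - I. degree E v = \<Delta>) \<and>
      (\<forall>x\<in>I. degree E x = \<delta> \<or> degree E x = card (V - I)) \<and> (real \<delta> + m) * e = 2 * real \<delta> * m * b"
proof -
  define d where "d v = real (degree E v)" for v
  have fin: "finite V" "finite I" and sub: "I \<subseteq> V"
    using fin_graph_finite(1)[OF G] I finite_subset by (auto simp: independent_def)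
  \<comment> \<open>\<open>X\<close> is the contribution of \<open>I\<close>; \<open>Y\<close> is
    the amount by which the rest falls short of \<open>\<Delta>\<close> squared at every
    vertex.\<close>
  define X Y where "X = (\<Sum>x\<in>I. (d x)\<^sup>2)" and "Y = (\<Sum>v\<in>V - I. (real \<Delta>)\<^sup>2 - (d v)\<^sup>2)"
  define C where "C = (e * (real \<delta> + m))\<^sup>2 / (4 * real \<delta> * m * b)"
  have split: "real (first_zagreb V E) = X + (m * (real \<Delta>)\<^sup>2 - Y)"
    using sum.subset_diff[OF sub fin(1), of "\<lambda>v. (d v)\<^sup>2"]
    by (simp add: first_zagreb_def X_def Y_def d_def m_def sum_subtractf)
  have Y_pos: "(real \<Delta>)\<^sup>2 - (d v)\<^sup>2 \<ge> 0" if "v \<in> V - I" for v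
    using \<Delta>[of v] that by (simp add: d_def power_mono)
  then have Y: "Y \<ge> 0" unfolding Y_def by (intro sum_nonneg)
  have "Y = 0 \<longleftrightarrow> (\<forall>v\<in>V - I. (real \<Delta>)\<^sup>2 - (d v)\<^sup>2 = 0)"
    unfolding Y_def using fin Y_pos by (intro sum_nonneg_eq_0_iff) auto
  then have Y0: "Y = 0 \<longleftrightarrow> (\<forall>v\<in>V - I. degree E v = \<Delta>)"
    by (auto simp: d_def)
  have d: "real \<delta> \<le> d x \<and> d x \<le> m" if "x \<in> I" for x
    using \<delta>(2)[of x] degree_le_independent[OF G I(1) that] that sub
    by (auto simp: d_def m_def)
  have sum_d: "sum d I = real (\<Sum>x\<in>I. degree E x)" by (simp add: d_def)
  then have "sum d I \<le> e"
    using sum_degree_independent_le[OF G I(1)] unfolding e_def by linarith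
  \<comment> \<open>The instance has \<open>a = \<delta>\<close>, \<open>b = m\<close> and
    \<open>t = e\<close>; positivity of \<open>a\<close> is left open and later discharged by
    \<open>\<delta> \<ge> 1\<close>.\<close>
  note X = sum_power2_bound[where d = d and I = I, OF fin(2) I(2) _ d this, folded X_def b_def]
  have "X \<le> C" unfolding C_def using X(1) \<delta>(1) by simp
  then show "real (first_zagreb V E) \<le> B"
    using Y split by (simp add: B_def C_def)
  have "real (first_zagreb V E) = B \<longleftrightarrow> Y = 0 \<and> X = C"
    using Y \<open>X \<le> C\<close> split by (auto simp: B_def C_def)
  also have "X = C \<longleftrightarrow> sum d I = e \<and> (\<forall>x\<in>I. d x = real \<delta> \<or> d x = m) \<and>
      (real \<delta> + m) * e = 2 * real \<delta> * m * b"
    unfolding C_def using X(2) \<delta>(1) by simp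
  also have "sum d I = e \<longleftrightarrow> bipartite_with V E I (V - I)"
    unfolding sum_d e_def bipartite_with_iff_sum_degree[OF G I(1)] by (rule of_nat_eq_iff)
  finally show "real (first_zagreb V E) = B \<longleftrightarrow>
      bipartite_with V E I (V - I) \<and> (\<forall>v\<in>V - I. degree E v = \<Delta>) \<and>
      (\<forall>x\<in>I. degree E x = \<delta> \<or> degree E x = card (V - I)) \<and> (real \<delta> + m) * e = 2 * real \<delta> * m * b"
    unfolding Y0 by (auto simp: d_def m_def)
qed

section \<open>Parameters of the extremal graphs\<close>

text \<open>Only two degrees occur, \<open>card B\<close> on \<open>A\<close> and
  \<open>card A\<close> on \<open>B\<close>; \<open>card B \<le> card A\<close> decides which is the
  minimum. Summing degrees over \<open>A\<close> counts every edge once.\<close>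

lemma complete_bipartite_parameters:
  assumes G: "fin_graph V E" and bip: "bipartite_with V E A B"
    and full: "\<forall>x\<in>A. \<forall>y\<in>B. {x, y} \<in> E" and "A \<noteq> {}" "B \<noteq> {}" and le: "card B \<le> card A"
  shows "min_degree V E = card B" "max_degree V E = card A" "card E = card A * card B"
    and "\<And>x. x \<in> A \<Longrightarrow> degree E x = card B" "\<And>y. y \<in> B \<Longrightarrow> degree E y = card A"
proof -
  show A: "degree E x = card B" if "x \<in> A" for x
    using complete_bipartite_iff_degree[OF G bip] full that by blast
  show B: "degree E y = card A" if "y \<in> B" for y
    using complete_bipartite_iff_degree[OF G bip[unfolded bipartite_with_commute[of V E A B]]]
      full that by (metis insert_commute)
  have "V = A \<union> B" using bip by (simp add: bipartite_with_def)
  with A B \<open>A \<noteq> {}\<close> \<open>B \<noteq> {}\<close> have "degree E ` V = {card A, card B}" by (force simp: image_Un)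
  with le show "min_degree V E = card B" "max_degree V E = card A"
    by (auto simp: min_degree_def max_degree_def)
  have "card E = (\<Sum>x\<in>A. degree E x)"
    using bip bipartite_with_iff_sum_degree[OF G bipartite_with_independent(1)[OF bip]]
      bipartite_with_independent(3)[OF bip] by simp
  with A show "card E = card A * card B" by simp
qed

text \<open>Here \<open>p * m + q * a\<close> is the edge count when \<open>p\<close> vertices of \<open>I\<close> have degree \<open>m\<close> and \<open>q\<close> have degree \<open>a\<close>.\<close>

lemma two_class_solution:
  fixes a m p q b :: real
  assumes "0 < a" "a < m" "p + q = b"
  shows "(a + m) * (p * m + q * a) = 2 * a * m * b \<longleftrightarrow> p = a * b / (a + m) \<and> q = m * b / (a + m)"
proof -
  \<comment> \<open>Since \<open>b = p + q\<close>, the last factor is \<open>p * m - q * a\<close>: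
    the condition says that both classes account for equally many edges. As \<open>a < m\<close>,
    the factor \<open>m - a\<close> can be cancelled.\<close>
  have "(a + m) * (p * m + q * a) - 2 * a * m * b = (m - a) * (p * (a + m) - a * b)"
    unfolding assms(3)[symmetric] by (simp add: algebra_simps)
  then have "(a + m) * (p * m + q * a) = 2 * a * m * b \<longleftrightarrow> (m - a) * (p * (a + m) - a * b) = 0"
    by (metis eq_iff_diff_eq_0)
  also have "\<dots> \<longleftrightarrow> p * (a + m) = a * b"
    using assms(2) by simp
  also have "\<dots> \<longleftrightarrow> p = a * b / (a + m)"
    using assms(1,2) by (simp add: eq_divide_eq)
  also have "\<dots> \<longleftrightarrow> p = a * b / (a + m) \<and> q = m * b / (a + m)"
    using assms by (auto simp: field_simps)
  finally show ?thesis .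
qed

text \<open>This translates the numeric equality condition into the class sizes of the theorem. As
  \<open>\<delta> < m\<close>, the classes \<open>P\<close> and \<open>Q\<close> partition
  \<open>I\<close>, so summing degrees over \<open>I\<close> expresses \<open>card E\<close> through
  their sizes.\<close>

lemma two_degree_classes_iff:
  fixes \<delta> m :: nat
  assumes G: "fin_graph V E" and bip: "bipartite_with V E I (V - I)"
    and I: "finite I" "\<And>x. x \<in> I \<Longrightarrow> degree E x = \<delta> \<or> degree E x = m" and \<delta>: "1 \<le> \<delta>" "\<delta> < m"
  defines "P \<equiv> {x \<in> I. degree E x = m}" and "Q \<equiv> {x \<in> I. degree E x = \<delta>}"
  shows "(real \<delta> + real m) * real (card E) = 2 * real \<delta> * real m * real (card I) \<longleftrightarrow>
    real (card P) = real \<delta> * real (card I) / (real \<delta> + real m) \<and>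
    real (card Q) = real m * real (card I) / (real \<delta> + real m)"
proof -
  have PQ: "I = P \<union> Q" "P \<inter> Q = {}" "finite P" "finite Q"
    using I \<delta> by (auto simp: P_def Q_def)
  have "card E = (\<Sum>x\<in>I. degree E x)"
    using bip bipartite_with_iff_sum_degree[OF G bipartite_with_independent(1)[OF bip]] by simp
  also have "\<dots> = (\<Sum>x\<in>P. degree E x) + (\<Sum>x\<in>Q. degree E x)"
    using PQ by (metis sum.union_disjoint)
  also have "\<dots> = card P * m + card Q * \<delta>"
    by (simp add: P_def Q_def)
  finally have "real (card E) = real (card P) * real m + real (card Q) * real \<delta>" by simp
  moreover have "real (card P) + real (card Q) = real (card I)"
    using PQ by (metis card_Un_disjoint of_nat_add)
  ultimately show ?thesis
    using two_class_solution[of "real \<delta>" "real m" "real (card P)" "real (card Q)"] \<delta> by simp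
qed

section \<open>The bound and its equality cases for maximum independent sets\<close>

theorem theorem3:
  fixes V :: "'a set" and E :: "'a set set"
    and n e \<delta> \<Delta> \<beta> :: nat and bound :: real
  assumes "fin_graph V E" and "V \<noteq> {}"
    and "n = card V" and "e = card E"
    and "\<delta> = min_degree V E" and "\<delta> \<ge> 1"
    and "\<Delta> = max_degree V E"
    and "\<beta> = independence_number V E"
    and "bound = (real n - real \<beta>) * (real \<Delta>)\<^sup>2
           + (real e * (real \<delta> + real n - real \<beta>))\<^sup>2
             / (4 * real \<delta> * (real n - real \<beta>) * real \<beta>)"
  shows "real (first_zagreb V E) \<le> bound \<and>
    (real (first_zagreb V E) = bound \<longleftrightarrow>
      is_complete_bipartite V E \<beta> (n - \<beta>) \<or>
      (\<exists>I P Q. bipartite_with V E I (V - I) \<and> card I = \<beta> \<and> \<delta> < n - \<beta> \<and>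
         (\<forall>v\<in>V - I. degree E v = \<Delta>) \<and>
         I = P \<union> Q \<and>
         P = {x \<in> I. degree E x = n - \<beta>} \<and>
         Q = {y \<in> I. degree E y = \<delta>} \<and>
         real (card P) = real \<delta> * real \<beta> / (real \<delta> + real n - real \<beta>) \<and>
         real (card Q) = (real n - real \<beta>) * real \<beta> / (real \<delta> + real n - real \<beta>)))"
proof -
  note G = assms(1)
  have fin: "finite V" using fin_graph_finite(1)[OF G] .
  have \<delta>_le: "\<delta> \<le> degree E v" and \<Delta>_ge: "degree E v \<le> \<Delta>" if "v \<in> V" for v
    using fin that assms(5,7) by (auto simp: min_degree_def max_degree_def)
  obtain v where v: "v \<in> V" using assms(2) by blast
  \<comment> \<open>Without loops a single vertex is independent, so \<open>\<beta> \<ge> 1\<close>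
    and maximum independent sets are nonempty.\<close>
  have "{v} \<notin> E" using G by (auto simp: fin_graph_def nsets_def)
  with v have "independent V E {v}" by (simp add: independent_def)
  then have \<beta>: "\<beta> \<ge> 1" using card_independent_le[OF fin] assms(8) by fastforce
  \<comment> \<open>Both forms of the size of \<open>V - I\<close> are kept: \<open>bound\<close>
    subtracts reals, the degree conditions subtract naturals. The last fact holds because a vertex
    of \<open>I\<close> has at least \<open>\<delta>\<close> neighbours, all outside
    \<open>I\<close>.\<close>
  have max_indep: "I \<noteq> {}" "card (V - I) = n - \<beta>" "real (card (V - I)) = real n - real \<beta>"
    "\<delta> \<le> n - \<beta>"
    if I: "independent V E I" "card I = \<beta>" for I
  proof -
    show ne: "I \<noteq> {}" using \<beta> I by auto
    have "I \<subseteq> V" using I by (simp add: independent_def)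
    then show c: "card (V - I) = n - \<beta>" and "real (card (V - I)) = real n - real \<beta>"
      using I fin assms(3) card_mono[OF fin] by (auto simp: card_Diff_subset finite_subset of_nat_diff)
    from ne obtain x where "x \<in> I" by blast
    with \<open>I \<subseteq> V\<close> show "\<delta> \<le> n - \<beta>"
      using \<delta>_le[of x] degree_le_independent[OF G I(1), of x] c by auto
  qed
  \<comment> \<open>The criterion is proved for every independent set of size
    \<open>\<beta>\<close>: the forward direction applies it to a chosen \<open>J\<close>, the
    converses to the part provided by the given bipartition.\<close>
  have bound: "real (first_zagreb V E) \<le> bound"
    and bound_eq: "real (first_zagreb V E) = bound \<longleftrightarrow>
      bipartite_with V E I (V - I) \<and> (\<forall>v\<in>V - I. degree E v = \<Delta>) \<and>
      (\<forall>x\<in>I. degree E x = \<delta> \<or> degree E x = n - \<beta>) \<and>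
      (real \<delta> + real (n - \<beta>)) * real e = 2 * real \<delta> * real (n - \<beta>) * real \<beta>"
    if I: "independent V E I" "card I = \<beta>" for I
  proof -
    note mi = max_indep[OF I]
    have m: "real (n - \<beta>) = real n - real \<beta>" using mi by simp
    have b: "bound = real (n - \<beta>) * (real \<Delta>)\<^sup>2 + (real (card E) * (real \<delta> + real (n - \<beta>)))\<^sup>2 /
        (4 * real \<delta> * real (n - \<beta>) * real \<beta>)"
      unfolding assms(9) assms(4) m by (simp add: algebra_simps)
    note z = zagreb_bound_independent[OF G I(1) mi(1) assms(6) \<delta>_le \<Delta>_ge,
        unfolded mi(2) I(2), folded b]
    show "real (first_zagreb V E) \<le> bound" by (rule z(1))
    show "real (first_zagreb V E) = bound \<longleftrightarrow>
      bipartite_with V E I (V - I) \<and> (\<forall>v\<in>V - I. degree E v = \<Delta>) \<and>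
      (\<forall>x\<in>I. degree E x = \<delta> \<or> degree E x = n - \<beta>) \<and>
      (real \<delta> + real (n - \<beta>)) * real e = 2 * real \<delta> * real (n - \<beta>) * real \<beta>"
      using z(2) assms(4) by simp
  qed
  obtain J where J: "independent V E J" "card J = \<beta>"
    using maximum_independentE[OF fin] assms(8) by metis
  note mJ = max_indep[OF J]
  have m: "real (n - \<beta>) = real n - real \<beta>" using mJ by simp
  have sizes: "(real \<delta> + real (n - \<beta>)) * real e = 2 * real \<delta> * real (n - \<beta>) * real \<beta> \<longleftrightarrow>
      real (card {x \<in> I. degree E x = n - \<beta>}) = real \<delta> * real \<beta> / (real \<delta> + real n - real \<beta>) \<and>
      real (card {x \<in> I. degree E x = \<delta>}) = (real n - real \<beta>) * real \<beta> / (real \<delta> + real n - real \<beta>)"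
    if "bipartite_with V E I (V - I)" "card I = \<beta>" "\<delta> < n - \<beta>"
      "\<And>x. x \<in> I \<Longrightarrow> degree E x = \<delta> \<or> degree E x = n - \<beta>" for I
    using two_degree_classes_iff[OF G that(1) _ that(4) assms(6) that(3)] that(2) \<beta> assms(4)
    by (simp add: m card_ge_0_finite add_diff_eq)
  let ?K = "is_complete_bipartite V E \<beta> (n - \<beta>)"
  let ?R = "\<lambda>I P Q. bipartite_with V E I (V - I) \<and> card I = \<beta> \<and> \<delta> < n - \<beta> \<and>
         (\<forall>v\<in>V - I. degree E v = \<Delta>) \<and>
         I = P \<union> Q \<and>
         P = {x \<in> I. degree E x = n - \<beta>} \<and>
         Q = {y \<in> I. degree E y = \<delta>} \<and>
         real (card P) = real \<delta> * real \<beta> / (real \<delta> + real n - real \<beta>) \<and>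
         real (card Q) = (real n - real \<beta>) * real \<beta> / (real \<delta> + real n - real \<beta>)"
  have "?K \<or> (\<exists>I P Q. ?R I P Q)" if "real (first_zagreb V E) = bound"
  proof -
    have eq: "bipartite_with V E J (V - J)" "\<forall>v\<in>V - J. degree E v = \<Delta>"
      "\<forall>x\<in>J. degree E x = \<delta> \<or> degree E x = n - \<beta>"
      "(real \<delta> + real (n - \<beta>)) * real e = 2 * real \<delta> * real (n - \<beta>) * real \<beta>"
      using that bound_eq[OF J] by auto
    show ?thesis
    \<comment> \<open>If the two admissible degrees coincide, every vertex of \<open>J\<close> is
      joined to all of \<open>V - J\<close>, giving the complete bipartite graph. Otherwise the
      degree classes are distinct and \<open>sizes\<close> applies.\<close>
    proof (cases "\<delta> = n - \<beta>")
      case True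
      then have "\<forall>x\<in>J. degree E x = card (V - J)" using eq(3) mJ(2) by simp
      then have "\<forall>x\<in>J. \<forall>y\<in>V - J. {x, y} \<in> E"
        using complete_bipartite_iff_degree[OF G eq(1)] by blast
      with eq(1) J(2) mJ(2) show ?thesis unfolding is_complete_bipartite_def by blast
    next
      case False
      then have "\<delta> < n - \<beta>" using mJ(4) by simp
      moreover from this have "J = {x \<in> J. degree E x = n - \<beta>} \<union> {y \<in> J. degree E y = \<delta>}"
        using eq(3) by blast
      ultimately have "?R J {x \<in> J. degree E x = n - \<beta>} {y \<in> J. degree E y = \<delta>}"
        using sizes[OF eq(1) J(2)] eq J(2) by blast
      then show ?thesis by blast
    qed
  qed
  moreover have "real (first_zagreb V E) = bound" if K: "?K"
  proof -
    obtain A B where AB: "bipartite_with V E A B" "card A = \<beta>" "card B = n - \<beta>"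
      "\<forall>x\<in>A. \<forall>y\<in>B. {x, y} \<in> E"
      using K unfolding is_complete_bipartite_def by blast
    note ind = bipartite_with_independent[OF AB(1)]
    have ne: "A \<noteq> {}" "B \<noteq> {}" using AB \<beta> mJ(4) assms(6) by auto
    \<comment> \<open>The part \<open>B\<close> is independent too, and \<open>A\<close> already has
      the maximum size \<open>\<beta>\<close>.\<close>
    have le: "card B \<le> card A" using card_independent_le[OF fin ind(2)] AB assms(8) by simp
    note p = complete_bipartite_parameters[OF G AB(1,4) ne le]
    \<comment> \<open>With these values both sides of the numeric condition equal
      \<open>2 * (n - \<beta>) * (n - \<beta>) * \<beta>\<close>.\<close>
    have "\<delta> = n - \<beta>" "\<Delta> = \<beta>" "e = \<beta> * (n - \<beta>)" using p(1-3) AB assms by auto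
    then show ?thesis
      unfolding bound_eq[OF ind(1) AB(2)] using AB(1-3) p(4,5) ind(3) by auto
  qed
  moreover have "real (first_zagreb V E) = bound" if R: "?R I P Q" for I P Q
  proof -
    have bip: "bipartite_with V E I (V - I)" and I: "card I = \<beta>" and lt: "\<delta> < n - \<beta>"
      and P: "P = {x \<in> I. degree E x = n - \<beta>}" and Q: "Q = {y \<in> I. degree E y = \<delta>}"
      and cards: "real (card P) = real \<delta> * real \<beta> / (real \<delta> + real n - real \<beta>)"
        "real (card Q) = (real n - real \<beta>) * real \<beta> / (real \<delta> + real n - real \<beta>)"
      using R by blast+
    \<comment> \<open>This is the content of \<open>I = P \<union> Q\<close>; it allows
      \<open>sizes\<close> to be read from right to left.\<close>
    have deg: "degree E x = \<delta> \<or> degree E x = n - \<beta>" if "x \<in> I" for x using R that by blast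
    have "(real \<delta> + real (n - \<beta>)) * real e = 2 * real \<delta> * real (n - \<beta>) * real \<beta>"
      using sizes[OF bip I lt deg] cards unfolding P Q by blast
    with R deg show ?thesis
      unfolding bound_eq[OF bipartite_with_independent(1)[OF bip] I] by blast
  qed
  ultimately show ?thesis using bound[OF J] by blast
qed

end
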